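(* Let $\mathcal{K}$ be a reflexive (complete idempotent) semiring, let $(Y,X)$ be a pre-dual pair for $\mathcal{K}$ such that $Y$ separates $X$, and let $W\subset X^2$ be a complete polar cone. If $s,t\in X$ are such that $(s,t)\notin W$, then there exists $y\in Y$ such that $$(f,g)\in W\implies\langle y\mid f\rangle\leq\langle y\mid g\rangle$$ and $$\langle y\mid s\rangle\not\leq\langle y\mid t\rangle.$$
   Context: An idempotent semiring $(\mathcal{K},\oplus,\otimes,\varepsilon,e)$ is ordered by the natural order $a\leq b\iff a\oplus b=b$; $\vee Q$ denotes the least upper bound of $Q$. A map $F$ between ordered sets in which every subset has a least upper bound is continuous if $F(\vee Q)=\vee F(Q)$ for all subsets $Q$. $\mathcal{K}$ is complete if every subset has a least upper bound and all left and right multiplications are continuous. A complete idempotent semiring $\mathcal{K}$ is reflexive if there exists $\varphi\in\mathcal{K}$ such that, setting $\lambda^-:=\vee\{\mu\in\mathcal{K}\mid\lambda\mu\leq\varphi\}$ and ${}^-\lambda:=\vee\{\mu\in\mathcal{K}\mid\mu\lambda\leq\varphi\}$, one has ${}^-(\lambda^-)=\lambda$ and $({}^-\lambda)^-=\lambda$ for all $\lambda\in\mathcal{K}$. A right $\mathcal{K}$-semimodule $X$ is a commutative monoid $(X,\oplus,\varepsilon)$ with a right action satisfying $(x\oplus z)\lambda=x\lambda\oplus z\lambda$, $x(\lambda\oplus\mu)=x\lambda\oplus x\mu$, $x(\lambda\mu)=(x\lambda)\mu$, $x\varepsilon=\varepsilon$, $\varepsilon\lambda=\varepsilon$, $xe=x$;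 it is then idempotent and naturally ordered by $x\le z\iff x\oplus z=z$. It is complete if every subset has a least upper bound and the maps $z\mapsto z\lambda$ ($X\to X$) and $\mu\mapsto u\mu$ ($\mathcal{K}\to X$) are continuous for all $\lambda\in\mathcal{K}$, $u\in X$. Left semimodules are defined dually. A pre-dual pair $(Y,X)$ for $\mathcal{K}$ consists of a complete right $\mathcal{K}$-semimodule $X$ and a complete left $\mathcal{K}$-semimodule $Y$ with a bracket $\langle\cdot\mid\cdot\rangle:Y\times X\to\mathcal{K}$ such that for all $x\in X$, $y\in Y$ the maps $y\mapsto\langle y\mid x\rangle$ and $x\mapsto\langle y\mid x\rangle$ are respectively left and right linear (preserve finite sums and commute with the scalar action), and continuous. $Y$ separates $X$ if $(\forall y\in Y,\ \langle y\mid x\rangle=\langle y\mid x'\rangle)\implies x=x'$. A subsemimodule is a subset stable under all $x\lambda\oplus z\mu$; it is complete if it contains $\vee Q$ for each of its subsets $Q$. $X^2$ carries componentwise operations. A polar cone is a subsemimodule $W\subset X^2$ such that $(f,f)\in W$ for all $f\in X$; $(f,g),(g,h)\in W\implies(f,h)\in W$; and $f\leq g\implies(f,g)\in W$. A complete polar cone is one that is complete as a subsemimodule. *)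

theory Defs
  imports Main "HOL-Library.Product_Plus" "HOL-Library.Product_Order"
begin

text \<open>
  The axiom says that the order of the complete lattice is the natural order of the monoid, so that
  addition is idempotent (by reflexivity of the order), \<open>x + y = sup x y\<close> and \<open>0 = bot\<close>.
  As an ordered set with all least upper bounds is a complete lattice, the class
  contains exactly the idempotent commutative monoids whose subsets all have a least upper
  bound in the natural order.
\<close>

class complete_idem_monoid = comm_monoid_add + complete_lattice +
  assumes le_iff_add_eq: "a \<le> b \<longleftrightarrow> a + b = b"

text \<open>The order and the suprema of the square of a monoid are thus again the natural ones.\<close>

instance prod :: (complete_idem_monoid, complete_idem_monoid) complete_idem_monoid
  by standard (auto simp: less_eq_prod_def le_iff_add_eq prod_eq_iff)

text \<open>Arbitrary sets are meant, including the empty one.\<close>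

definition lub_continuous :: "('a::complete_lattice \<Rightarrow> 'b::complete_lattice) \<Rightarrow> bool" where
  "lub_continuous F \<longleftrightarrow> (\<forall>Q. F (Sup Q) = Sup (F ` Q))"

text \<open>
  The class \<open>semiring_0\<close> together with \<open>monoid_mult\<close> is used instead of \<open>semiring_1\<close>,
  because the latter excludes the trivial semiring. The two axioms are the
  continuity of the left and right multiplications.
\<close>

class complete_idem_semiring = semiring_0 + monoid_mult + complete_idem_monoid +
  assumes mult_Sup: "a * Sup Q = Sup ((\<lambda>b. a * b) ` Q)"
    and Sup_mult: "Sup Q * a = Sup ((\<lambda>b. b * a) ` Q)"
begin

text \<open>These are \<open>\<lambda>\<^sup>-\<close> and \<open>\<^sup>-\<lambda>\<close>, for a given \<open>\<phi>\<close>.\<close>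

definition right_conj :: "'a \<Rightarrow> 'a \<Rightarrow> 'a" where
  "right_conj \<phi> l = Sup {m. l * m \<le> \<phi>}"

definition left_conj :: "'a \<Rightarrow> 'a \<Rightarrow> 'a" where
  "left_conj \<phi> l = Sup {m. m * l \<le> \<phi>}"

end

class reflexive_semiring = complete_idem_semiring +
  assumes reflexive:
    "\<exists>\<phi>. \<forall>l. left_conj \<phi> (right_conj \<phi> l) = l \<and> right_conj \<phi> (left_conj \<phi> l) = l"

locale right_semimodule =
  fixes scale :: "'x::comm_monoid_add \<Rightarrow> 'k::{semiring_0,monoid_mult} \<Rightarrow> 'x"
  assumes add_scale: "scale (x + z) l = scale x l + scale z l"
    and scale_add: "scale x (l + m) = scale x l + scale x m"
    and scale_mult: "scale x (l * m) = scale (scale x l) m"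
    and scale_zero: "scale x 0 = 0"
    and zero_scale: "scale 0 l = 0"
    and scale_one: "scale x 1 = x"

locale left_semimodule =
  fixes scale :: "'k::{semiring_0,monoid_mult} \<Rightarrow> 'y::comm_monoid_add \<Rightarrow> 'y"
  assumes scale_add: "scale l (y + z) = scale l y + scale l z"
    and add_scale: "scale (l + m) y = scale l y + scale m y"
    and mult_scale: "scale (l * m) y = scale l (scale m y)"
    and zero_scale: "scale 0 y = 0"
    and scale_zero: "scale l 0 = 0"
    and one_scale: "scale 1 y = y"

locale complete_right_semimodule = right_semimodule scale
  for scale :: "'x::complete_idem_monoid \<Rightarrow> 'k::complete_idem_semiring \<Rightarrow> 'x" +
  assumes continuous_scale: "lub_continuous (\<lambda>z. scale z l)"
    and continuous_action: "lub_continuous (\<lambda>m. scale u m)"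

locale complete_left_semimodule = left_semimodule scale
  for scale :: "'k::complete_idem_semiring \<Rightarrow> 'y::complete_idem_monoid \<Rightarrow> 'y" +
  assumes continuous_scale: "lub_continuous (\<lambda>z. scale l z)"
    and continuous_action: "lub_continuous (\<lambda>m. scale m u)"

locale predual_pair =
  Y: complete_left_semimodule lscale + X: complete_right_semimodule rscale
  for lscale :: "'k::complete_idem_semiring \<Rightarrow> 'y::complete_idem_monoid \<Rightarrow> 'y"
    and rscale :: "'x::complete_idem_monoid \<Rightarrow> 'k \<Rightarrow> 'x" +
  fixes bracket :: "'y \<Rightarrow> 'x \<Rightarrow> 'k"
  assumes bracket_zero_left: "bracket 0 x = 0"
    and bracket_add_left: "bracket (y + y') x = bracket y x + bracket y' x"
    and bracket_scale_left: "bracket (lscale l y) x = l * bracket y x"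
    and bracket_zero_right: "bracket y 0 = 0"
    and bracket_add_right: "bracket y (x + x') = bracket y x + bracket y x'"
    and bracket_scale_right: "bracket y (rscale x l) = bracket y x * l"
    and continuous_left: "lub_continuous (\<lambda>y. bracket y x)"
    and continuous_right: "lub_continuous (\<lambda>x. bracket y x)"

definition separates :: "('y \<Rightarrow> 'x \<Rightarrow> 'k) \<Rightarrow> bool" where
  "separates bracket \<longleftrightarrow> (\<forall>x x'. (\<forall>y. bracket y x = bracket y x') \<longrightarrow> x = x')"

definition subsemimodule :: "('x::plus \<Rightarrow> 'k \<Rightarrow> 'x) \<Rightarrow> 'x set \<Rightarrow> bool" where
  "subsemimodule scale V \<longleftrightarrow> (\<forall>x\<in>V. \<forall>z\<in>V. \<forall>l m. scale x l + scale z m \<in> V)"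

definition complete_subsemimodule ::
    "('x::complete_idem_monoid \<Rightarrow> 'k \<Rightarrow> 'x) \<Rightarrow> 'x set \<Rightarrow> bool" where
  "complete_subsemimodule scale V \<longleftrightarrow> subsemimodule scale V \<and> (\<forall>Q\<subseteq>V. Sup Q \<in> V)"

definition square_scale :: "('x \<Rightarrow> 'k \<Rightarrow> 'x) \<Rightarrow> 'x \<times> 'x \<Rightarrow> 'k \<Rightarrow> 'x \<times> 'x" where
  "square_scale scale p l = (scale (fst p) l, scale (snd p) l)"

definition polar_cone ::
    "('x::complete_idem_monoid \<Rightarrow> 'k \<Rightarrow> 'x) \<Rightarrow> ('x \<times> 'x) set \<Rightarrow> bool" where
  "polar_cone scale W \<longleftrightarrow>
     subsemimodule (square_scale scale) W \<and>
     (\<forall>f. (f, f) \<in> W) \<and>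
     (\<forall>f g h. (f, g) \<in> W \<longrightarrow> (g, h) \<in> W \<longrightarrow> (f, h) \<in> W) \<and>
     (\<forall>f g. f \<le> g \<longrightarrow> (f, g) \<in> W)"

definition complete_polar_cone ::
    "('x::complete_idem_monoid \<Rightarrow> 'k \<Rightarrow> 'x) \<Rightarrow> ('x \<times> 'x) set \<Rightarrow> bool" where
  "complete_polar_cone scale W \<longleftrightarrow>
     polar_cone scale W \<and> complete_subsemimodule (square_scale scale) W"

end

theory Submission
  imports Defs
begin

text \<open>
  Let \<open>T\<close> be the largest element with \<open>(T, t) \<in> W\<close>, and let \<open>y\<close> be the largest element with
  \<open>\<langle>y|T\<rangle> \<le> \<phi>\<close>. Separation and reflexivity make \<open>T\<close> closed for the Galois connection induced by
  \<open>\<langle>y|x\<rangle> \<le> \<phi>\<close>, so that \<open>\<langle>y|x\<rangle> \<le> \<phi>\<close> holds exactly when \<open>x \<le> T\<close>. By reflexivity an inequality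
  \<open>a \<le> b\<close> may be tested on the multipliers \<open>l\<close> with \<open>b l \<le> \<phi>\<close>; hence \<open>\<langle>y|f\<rangle> \<le> \<langle>y|g\<rangle>\<close> as soon as
  \<open>g l \<le> T\<close> implies \<open>f l \<le> T\<close> for all \<open>l\<close>, which is the case when \<open>(f, g) \<in> W\<close>.
\<close>

lemma add_self: "(a::'a::complete_idem_monoid) + a = a"
  using le_iff_add_eq by blast

text \<open>The order is the natural one, so \<open>a + b = b\<close> is carried by \<open>F\<close>
  to \<open>F a + F b = F b\<close>.\<close>

lemma additive_mono:
  fixes F :: "'a::complete_idem_monoid \<Rightarrow> 'b::complete_idem_monoid"
  assumes "\<And>a b. F (a + b) = F a + F b" and "a \<le> b"
  shows "F a \<le> F b"
  using assms by (metis le_iff_add_eq)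

lemma idem_mult_left_mono: "a \<le> b \<Longrightarrow> c * a \<le> c * b"
  for a b c :: "'k::complete_idem_semiring"
  by (rule additive_mono) (rule distrib_left)

lemma idem_mult_right_mono: "a \<le> b \<Longrightarrow> a * c \<le> b * c"
  for a b c :: "'k::complete_idem_semiring"
  by (rule additive_mono[where F = "\<lambda>a. a * c"]) (rule distrib_right)

lemma right_conj_antimono:
  fixes a b :: "'k::complete_idem_semiring"
  assumes "a \<le> b"
  shows "right_conj \<phi> b \<le> right_conj \<phi> a"
  unfolding right_conj_def
  using idem_mult_right_mono[OF assms] by (blast intro: Sup_subset_mono order_trans)

lemma left_conj_antimono:
  fixes a b :: "'k::complete_idem_semiring"
  assumes "a \<le> b"
  shows "left_conj \<phi> b \<le> left_conj \<phi> a"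
  unfolding left_conj_def
  using idem_mult_left_mono[OF assms] by (blast intro: Sup_subset_mono order_trans)

text \<open>The second hypothesis is an inclusion between the sets whose suprema are
  \<open>left_conj \<phi> b\<close> and \<open>left_conj \<phi> a\<close>; the antitone map
  \<open>right_conj \<phi>\<close> turns these back into \<open>b\<close> and
  \<open>a\<close>.\<close>

lemma le_if_left_multipliers:
  fixes a b :: "'k::complete_idem_semiring"
  assumes "\<And>l :: 'k. right_conj \<phi> (left_conj \<phi> l) = l"
    and "\<And>l. l * b \<le> \<phi> \<Longrightarrow> l * a \<le> \<phi>"
  shows "a \<le> b"
proof -
  have "left_conj \<phi> b \<le> left_conj \<phi> a"
    unfolding left_conj_def using assms(2) by (blast intro: Sup_subset_mono)
  from right_conj_antimono[OF this, of \<phi>] show ?thesis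
    by (simp add: assms(1))
qed

lemma le_if_right_multipliers:
  fixes a b :: "'k::complete_idem_semiring"
  assumes "\<And>l :: 'k. left_conj \<phi> (right_conj \<phi> l) = l"
    and "\<And>l. b * l \<le> \<phi> \<Longrightarrow> a * l \<le> \<phi>"
  shows "a \<le> b"
proof -
  have "right_conj \<phi> b \<le> right_conj \<phi> a"
    unfolding right_conj_def using assms(2) by (blast intro: Sup_subset_mono)
  from left_conj_antimono[OF this, of \<phi>] show ?thesis
    by (simp add: assms(1))
qed

text \<open>By idempotency, \<open>scale x l\<close> is the combination
  \<open>scale x l + scale x l\<close>.\<close>

lemma subsemimodule_scale:
  fixes V :: "'x::complete_idem_monoid set"
  assumes "subsemimodule scale V" and "x \<in> V"
  shows "scale x l \<in> V"
  using assms unfolding subsemimodule_def by (metis add_self)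

lemma lub_continuous_Sup_le:
  assumes "lub_continuous F" and "\<And>q. q \<in> Q \<Longrightarrow> F q \<le> c"
  shows "F (Sup Q) \<le> c"
  using assms unfolding lub_continuous_def by (simp add: SUP_le_iff)

context predual_pair
begin

lemma bracket_mono_left: "y \<le> y' \<Longrightarrow> bracket y x \<le> bracket y' x"
  by (rule additive_mono[where F = "\<lambda>y. bracket y x"]) (rule bracket_add_left)

lemma bracket_mono_right: "x \<le> x' \<Longrightarrow> bracket y x \<le> bracket y x'"
  by (rule additive_mono) (rule bracket_add_right)

lemma closed_if_separates:
  assumes refl: "\<And>l. right_conj \<phi> (left_conj \<phi> l) = l"
    and sep: "separates bracket"
  obtains y where "\<And>x. bracket y x \<le> \<phi> \<longleftrightarrow> x \<le> T"
proof -
  define y where "y = Sup {y. bracket y T \<le> \<phi>}"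
  \<comment> \<open>\<open>T'\<close> is the Galois closure of \<open>T\<close>; the goal is
    \<open>T' = T\<close>, which separation reduces to equality of all brackets.\<close>
  define T' where "T' = Sup {x. bracket y x \<le> \<phi>}"
  have yT: "bracket y T \<le> \<phi>"
    unfolding y_def by (rule lub_continuous_Sup_le[OF continuous_left]) simp
  have yT': "bracket y T' \<le> \<phi>"
    unfolding T'_def by (rule lub_continuous_Sup_le[OF continuous_right]) simp
  have "T \<le> T'"
    unfolding T'_def using yT by (simp add: Sup_upper)
  have "bracket z T' \<le> bracket z T" for z
  proof (rule le_if_left_multipliers[OF refl])
    fix l assume "l * bracket z T \<le> \<phi>"
    \<comment> \<open>Left multipliers are absorbed into the left argument, where \<open>y\<close>
      is the largest element whose bracket with \<open>T\<close> is below
      \<open>\<phi>\<close>.\<close>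
    then have "lscale l z \<le> y"
      unfolding y_def by (simp add: Sup_upper bracket_scale_left)
    then show "l * bracket z T' \<le> \<phi>"
      using bracket_mono_left yT' by (metis bracket_scale_left order_trans)
  qed
  then have "bracket z T' = bracket z T" for z
    using bracket_mono_right[OF \<open>T \<le> T'\<close>] by (simp add: antisym)
  then have "T' = T"
    using sep unfolding separates_def by blast
  then have "bracket y x \<le> \<phi> \<longleftrightarrow> x \<le> T" for x
    using bracket_mono_right yT unfolding T'_def by (metis Sup_upper mem_Collect_eq order_trans)
  then show thesis by (rule that)
qed

end

text \<open>The section of \<open>W\<close> at \<open>t\<close> contains its supremum by
  completeness, and it is a down-set by transitivity, since \<open>W\<close> contains the
  order.\<close>

lemma complete_polar_cone_greatest:
  assumes "complete_polar_cone scale W"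
  obtains T where "\<And>f. (f, t) \<in> W \<longleftrightarrow> f \<le> T"
proof -
  from assms have refl: "(f, f) \<in> W"
    and trans: "(f, g) \<in> W \<Longrightarrow> (g, h) \<in> W \<Longrightarrow> (f, h) \<in> W"
    and le: "f \<le> g \<Longrightarrow> (f, g) \<in> W"
    and Sup: "Q \<subseteq> W \<Longrightarrow> Sup Q \<in> W" for f g h Q
    unfolding complete_polar_cone_def polar_cone_def complete_subsemimodule_def by blast+
  define T where "T = Sup {f. (f, t) \<in> W}"
  \<comment> \<open>Suprema of pairs are componentwise; \<open>(t, t) \<in> W\<close> makes the
    family nonempty, so the second component is \<open>t\<close> and not \<open>bot\<close>.\<close>
  have "Sup ((\<lambda>f. (f, t)) ` {f. (f, t) \<in> W}) = (T, t)"
    using refl[of t]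
    by (auto simp: T_def Sup_prod_def image_image intro!: antisym SUP_least intro: SUP_upper)
  then have T: "(T, t) \<in> W"
    using Sup[of "(\<lambda>f. (f, t)) ` {f. (f, t) \<in> W}"] by auto
  then have "(f, t) \<in> W \<longleftrightarrow> f \<le> T" for f
    using trans le unfolding T_def by (blast intro: Sup_upper)
  then show thesis by (rule that)
qed

theorem corollary2:
  fixes lscale :: "'k::reflexive_semiring \<Rightarrow> 'y::complete_idem_monoid \<Rightarrow> 'y"
    and rscale :: "'x::complete_idem_monoid \<Rightarrow> 'k \<Rightarrow> 'x"
    and bracket :: "'y \<Rightarrow> 'x \<Rightarrow> 'k"
    and W :: "('x \<times> 'x) set"
    and s t :: 'x
  assumes "predual_pair lscale rscale bracket"
    and "separates bracket"
    and "complete_polar_cone rscale W"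
    and "(s, t) \<notin> W"
  shows "\<exists>y. (\<forall>f g. (f, g) \<in> W \<longrightarrow> bracket y f \<le> bracket y g) \<and>
             \<not> bracket y s \<le> bracket y t"
proof -
  interpret predual_pair lscale rscale bracket by fact
  obtain \<phi> :: 'k where left_right: "\<And>l. left_conj \<phi> (right_conj \<phi> l) = l"
    and right_left: "\<And>l. right_conj \<phi> (left_conj \<phi> l) = l"
    using reflexive by blast
  obtain T where T: "\<And>f. (f, t) \<in> W \<longleftrightarrow> f \<le> T"
    using complete_polar_cone_greatest[OF assms(3)] by blast
  obtain y where y: "\<And>x. bracket y x \<le> \<phi> \<longleftrightarrow> x \<le> T"
    using closed_if_separates[OF right_left assms(2)] by blast
  from assms(3) have W: "subsemimodule (square_scale rscale) W"
    and refl: "(f, f) \<in> W"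
    and trans: "(f, g) \<in> W \<Longrightarrow> (g, h) \<in> W \<Longrightarrow> (f, h) \<in> W" for f g h
    unfolding complete_polar_cone_def polar_cone_def by blast+
  have "bracket y f \<le> bracket y g" if "(f, g) \<in> W" for f g
  proof (rule le_if_right_multipliers[OF left_right])
    fix l assume "bracket y g * l \<le> \<phi>"
    then have "rscale g l \<le> T"
      by (simp add: bracket_scale_right[symmetric] y)
    moreover have "(rscale f l, rscale g l) \<in> W"
      using subsemimodule_scale[OF W that, of l] by (simp add: square_scale_def)
    ultimately have "rscale f l \<le> T"
      using T trans by blast
    then show "bracket y f * l \<le> \<phi>"
      by (simp add: bracket_scale_right[symmetric] y)
  qed
  \<comment> \<open>The value \<open>\<phi>\<close> separates the two brackets:
    \<open>t \<le> T\<close> by reflexivity of \<open>W\<close>, whereas \<open>s \<le> T\<close>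
    fails.\<close>
  moreover have "\<not> bracket y s \<le> bracket y t"
    using y T refl[of t] assms(4) by (meson order_trans)
  ultimately show ?thesis by blast
qed

end
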